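(* Let $p\in\mathbb{R}^+\smallsetminus\{\frac12\}$ and let $s\ge0$ be an integer. Then $$\mu_s^{\rm (E)}(p)=\frac{1}{b(s)}\sum_{T\in\mathcal{T}(s)}\ \prod_{v\in T}a(\ell_v)\,b(k_v),$$ where the product runs over the $s+1$ vertices of $T$ (root included), and $$a(\ell)=\frac{4^{\ell-1}\,\Gamma\left(\ell-\frac12\right)}{\sqrt\pi\,\Gamma(\ell+1)},\qquad b(k)=\frac{\Gamma\left((k+1)(p-\frac12)+k\right)}{2\,\Gamma\left(k(p-\frac12)+k-\frac12\right)} .$$
   Context: $\mathcal{T}(s)$ is the set of rooted planar trees with $s$ non-root vertices. For a vertex $v$ of $T$, $\ell_v$ is its out-going degree (number of children) and $k_v$ is its number of descendants (number of vertices of the subtree rooted at $v$, minus one). The coefficients $\mu_s^{\rm (E)}(p)$ are defined by $\mu_0^{\rm (E)}(p)=-\frac12$, $\mu_1^{\rm (E)}(p)=\frac{1}{8\sqrt\pi}\Gamma(p-\frac12)$, and for $s\ge2$ $$\mu_s^{\rm (E)}(p)=\mu_{s-1}^{\rm (E)}(p)\frac{\Gamma\left(s(p+\frac12)-1\right)}{2\,\Gamma\left(s(p+\frac12)-p-1\right)}+\sum_{k=1}^{s-1}\mu_k^{\rm (E)}(p)\,\mu_{s-k}^{\rm (E)}(p).$$ *)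

theory Defs
  imports "HOL-Analysis.Gamma_Function"
begin

datatype plane_tree = Node (children: "plane_tree list")

text \<open>
  A vertex is addressed by the sequence of child indices leading to it from the root,
  so the root is \<open>[]\<close> and distinct vertices with equal subtrees remain distinct.
\<close>

primrec is_vertex :: "nat list \<Rightarrow> plane_tree \<Rightarrow> bool" where
  "is_vertex [] t \<longleftrightarrow> True"
| "is_vertex (i # v) t \<longleftrightarrow> i < length (children t) \<and> is_vertex v (children t ! i)"

definition vertices :: "plane_tree \<Rightarrow> nat list set" where
  "vertices t = {v. is_vertex v t}"

primrec subtree_at :: "nat list \<Rightarrow> plane_tree \<Rightarrow> plane_tree" where
  "subtree_at [] t = t"
| "subtree_at (i # v) t = subtree_at v (children t ! i)"

definition out_degree :: "plane_tree \<Rightarrow> nat list \<Rightarrow> nat" where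
  "out_degree t v = length (children (subtree_at v t))"

definition num_descendants :: "plane_tree \<Rightarrow> nat list \<Rightarrow> nat" where
  "num_descendants t v = card (vertices (subtree_at v t)) - 1"

definition plane_trees :: "nat \<Rightarrow> plane_tree set" where
  "plane_trees s = {t. card (vertices t - {[]}) = s}"

text \<open>
  The finiteness facts below make sure that the cardinalities above and the sums and
  products over these sets have their intended meaning.
\<close>

lemma vertices_Node:
  "vertices (Node ts) = insert [] (\<Union>i<length ts. (#) i ` vertices (ts ! i))"
proof (rule set_eqI)
  fix v
  show "v \<in> vertices (Node ts) \<longleftrightarrow>
      v \<in> insert [] (\<Union>i<length ts. (#) i ` vertices (ts ! i))"
    by (cases v) (auto simp: vertices_def)
qed

lemma finite_vertices: "finite (vertices t)"
proof (induction t)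
  case (Node ts)
  then show ?case by (auto simp: vertices_Node)
qed

lemma finite_trees_card_le: "finite {t. card (vertices t) \<le> n}"
proof (induction n)
  case 0
  have "card (vertices t) \<noteq> 0" for t
    using finite_vertices[of t] by (cases t) (auto simp: vertices_Node)
  then have "{t. card (vertices t) \<le> 0} = {}" by simp
  then show ?case by (metis finite.emptyI)
next
  case (Suc n)
  let ?A = "{t. card (vertices t) \<le> n}"
  have "{t. card (vertices t) \<le> Suc n} \<subseteq> Node ` {ts. set ts \<subseteq> ?A \<and> length ts \<le> n}"
  proof
    fix t assume t: "t \<in> {t. card (vertices t) \<le> Suc n}"
    obtain ts where ts: "t = Node ts" by (cases t)
    let ?U = "\<Union>i<length ts. (#) i ` vertices (ts ! i)"
    have fin: "finite ?U" by (auto simp: finite_vertices)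
    have "[] \<notin> ?U" by auto
    then have le: "card ?U \<le> n"
      using t fin by (simp add: ts vertices_Node)
    have "card (vertices x) \<le> n" if x: "x \<in> set ts" for x
    proof -
      obtain i where i: "i < length ts" "x = ts ! i"
        using x by (auto simp: in_set_conv_nth)
      have "card (vertices x) = card ((#) i ` vertices x)"
        by (simp add: card_image)
      also have "\<dots> \<le> card ?U"
        using i by (intro card_mono fin) auto
      finally show ?thesis using le by simp
    qed
    moreover have "length ts \<le> n"
    proof -
      have "length ts = card ((\<lambda>i. [i]) ` {..<length ts})"
        by (subst card_image) (auto simp: inj_on_def)
      also have "\<dots> \<le> card ?U"
        by (intro card_mono fin) (auto simp: vertices_def)
      finally show ?thesis using le by simp
    qed
    ultimately show "t \<in> Node ` {ts. set ts \<subseteq> ?A \<and> length ts \<le> n}"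
      by (auto simp: ts)
  qed
  moreover have "finite {ts. set ts \<subseteq> ?A \<and> length ts \<le> n}"
    using Suc.IH by (rule finite_lists_length_le)
  ultimately show ?case by (meson finite_imageI finite_subset)
qed

lemma finite_plane_trees: "finite (plane_trees s)"
proof (rule finite_subset)
  show "plane_trees s \<subseteq> {t. card (vertices t) \<le> Suc s}"
  proof
    fix t assume "t \<in> plane_trees s"
    moreover have "[] \<in> vertices t" by (simp add: vertices_def)
    ultimately show "t \<in> {t. card (vertices t) \<le> Suc s}"
      using finite_vertices[of t] by (auto simp: plane_trees_def card_Diff_singleton)
  qed
qed (rule finite_trees_card_le)

text \<open>
  For \<open>p > 0\<close> and \<open>p \<noteq> 1/2\<close> none of the arguments of \<open>Gamma\<close> below that occur for the
  relevant indices is a pole, so the convention \<open>Gamma x = 0\<close> at poles plays no role.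
\<close>

function muE :: "real \<Rightarrow> nat \<Rightarrow> real" where
  "muE p s =
    (if s = 0 then - 1 / 2
     else if s = 1 then 1 / (8 * sqrt pi) * Gamma (p - 1 / 2)
     else muE p (s - 1) * (Gamma (real s * (p + 1 / 2) - 1)
              / (2 * Gamma (real s * (p + 1 / 2) - p - 1)))
          + (\<Sum>k = 1..s - 1. muE p k * muE p (s - k)))"
  by pat_completeness auto
termination by (relation "Wellfounded.measure snd") auto

declare muE.simps [simp del]

definition coeff_a :: "nat \<Rightarrow> real" where
  "coeff_a l = 4 powi (int l - 1) * Gamma (real l - 1 / 2) / (sqrt pi * Gamma (real l + 1))"

definition coeff_b :: "real \<Rightarrow> nat \<Rightarrow> real" where
  "coeff_b p k = Gamma ((real k + 1) * (p - 1 / 2) + real k)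
     / (2 * Gamma (real k * (p - 1 / 2) + real k - 1 / 2))"

end

theory Submission
  imports Defs "HOL-Computational_Algebra.Formal_Power_Series"
begin

text \<open>
  Let \<open>M\<close> be the generating function of \<open>muE p\<close>, \<open>A(x) = - sqrt (1 - 4 x) / 2\<close> that of
  \<open>coeff_a\<close>, and \<open>W\<close> that of the weighted tree sums. The quotient of Gamma functions in the
  recursion is \<open>coeff_b p (s - 1)\<close>, so the recursion for \<open>M\<close> says that
  \<open>M\<^sup>2 = 1 / 4 - X * N\<close>, where \<open>N\<close> has coefficients \<open>coeff_b p s * muE p s\<close>. Splitting a tree
  at its root gives \<open>W $ s = coeff_b p s * (A oo X * W) $ s\<close>, and \<open>A\<^sup>2 = 1 / 4 - X\<close>
  shows that \<open>A oo X * W\<close> satisfies the same recursion as \<open>M\<close>.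
\<close>

subsection \<open>Weighted sums over plane trees\<close>

abbreviation tree_size :: "plane_tree \<Rightarrow> nat" where
  "tree_size t \<equiv> card (vertices t)"

definition tree_weight :: "(nat \<Rightarrow> 'a) \<Rightarrow> (nat \<Rightarrow> 'a) \<Rightarrow> plane_tree \<Rightarrow> 'a::comm_semiring_1" where
  "tree_weight a b t = (\<Prod>v\<in>vertices t. a (out_degree t v) * b (num_descendants t v))"

text \<open>Here \<open>n\<close> counts every vertex, roots of the component trees included, so
  \<open>forests l s\<close> holds the possible child lists of a root with \<open>l\<close> children
  and \<open>s\<close> descendants.\<close>

definition forests :: "nat \<Rightarrow> nat \<Rightarrow> plane_tree list set" where
  "forests l n = {ts. length ts = l \<and> sum_list (map tree_size ts) = n}"

lemma tree_size_Node: "tree_size (Node ts) = Suc (sum_list (map tree_size ts))"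
proof -
  have "card (\<Union>i<length ts. (#) i ` vertices (ts ! i)) = (\<Sum>i<length ts. tree_size (ts ! i))"
    by (subst card_UN_disjoint) (auto simp: finite_vertices card_image)
  also have "\<dots> = sum_list (map tree_size ts)"
    by (simp add: sum_list_sum_nth atLeast0LessThan)
  finally have "card (\<Union>i<length ts. (#) i ` vertices (ts ! i)) = sum_list (map tree_size ts)" .
  then show ?thesis
    by (subst vertices_Node, subst card_insert_disjoint) (auto simp: finite_vertices)
qed

lemma tree_size_pos: "tree_size t > 0"
  by (cases t) (simp add: tree_size_Node)

lemma plane_trees_eq: "plane_trees s = {t. tree_size t = Suc s}"
proof -
  have "card (vertices t - {[]}) = tree_size t - 1" for t
    by (subst card_Diff_singleton) (auto simp: vertices_def)
  then show ?thesis
    using tree_size_pos by (auto simp: plane_trees_def)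
qed

lemma finite_tree_size_eq: "finite {t. tree_size t = n}"
  by (rule finite_subset[OF _ finite_trees_card_le[of n]]) auto

text \<open>The root has as many descendants as its child trees have vertices in all; below the
  root, out-degrees and descendant counts agree with those taken inside the child trees.\<close>

lemma tree_weight_Node:
  "tree_weight a b (Node ts) =
    a (length ts) * b (sum_list (map tree_size ts)) * prod_list (map (tree_weight a b) ts)"
proof -
  let ?f = "\<lambda>t v. a (out_degree t v) * b (num_descendants t v)"
  have "(\<Prod>v\<in>(\<Union>i<length ts. (#) i ` vertices (ts ! i)). ?f (Node ts) v)
      = (\<Prod>i<length ts. \<Prod>v\<in>(#) i ` vertices (ts ! i). ?f (Node ts) v)"
    by (rule prod.UNION_disjoint) (auto simp: finite_vertices)
  also have "\<dots> = (\<Prod>i<length ts. tree_weight a b (ts ! i))"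
    by (intro prod.cong refl, subst prod.reindex)
       (auto simp: tree_weight_def out_degree_def num_descendants_def)
  also have "\<dots> = prod_list (map (tree_weight a b) ts)"
    by (simp add: prod.list_conv_set_nth atLeast0LessThan)
  finally have *: "(\<Prod>v\<in>(\<Union>i<length ts. (#) i ` vertices (ts ! i)). ?f (Node ts) v)
      = prod_list (map (tree_weight a b) ts)" .
  have "tree_weight a b (Node ts) = ?f (Node ts) [] *
      (\<Prod>v\<in>(\<Union>i<length ts. (#) i ` vertices (ts ! i)). ?f (Node ts) v)"
    unfolding tree_weight_def
    by (subst vertices_Node, subst prod.insert) (auto simp: finite_vertices)
  also have "?f (Node ts) [] = a (length ts) * b (sum_list (map tree_size ts))"
    by (simp add: out_degree_def num_descendants_def tree_size_Node)
  finally show ?thesis by (simp only: *)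
qed

lemma forests_Suc:
  "forests (Suc l) n = (\<Union>k\<le>n. (\<lambda>(t, ts). t # ts) ` ({t. tree_size t = k} \<times> forests l (n - k)))"
proof (rule set_eqI)
  fix us
  show "us \<in> forests (Suc l) n \<longleftrightarrow>
      us \<in> (\<Union>k\<le>n. (\<lambda>(t, ts). t # ts) ` ({t. tree_size t = k} \<times> forests l (n - k)))"
    by (cases us) (auto simp: forests_def image_iff)
qed

lemma finite_forests: "finite (forests l n)"
proof (induction l arbitrary: n)
  case 0
  have "forests 0 n \<subseteq> {[]}" by (auto simp: forests_def)
  then show ?case by (rule finite_subset) simp
next
  case (Suc l)
  then show ?case by (auto simp: forests_Suc finite_tree_size_eq)
qed

lemma forests_empty: "forests l n = {}" if "n < l"
proof -
  have "length ts \<le> sum_list (map tree_size ts)" for ts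
  proof (induction ts)
    case (Cons t ts)
    then show ?case using tree_size_pos[of t] by simp
  qed simp
  with that show ?thesis by (auto simp: forests_def) (metis leD)
qed

text \<open>Splitting off the first tree of a forest is a Cauchy product, so each further tree
  contributes one more factor of the generating function by size.\<close>

lemma sum_forests:
  fixes w :: "plane_tree \<Rightarrow> 'a::comm_semiring_1"
  shows "(\<Sum>ts\<in>forests l n. prod_list (map w ts))
    = fps_nth (Abs_fps (\<lambda>m. \<Sum>t | tree_size t = m. w t) ^ l) n"
proof (induction l arbitrary: n)
  case 0
  have "forests 0 n = (if n = 0 then {[]} else {})" by (auto simp: forests_def)
  then show ?case by simp
next
  case (Suc l)
  have "(\<Sum>us\<in>forests (Suc l) n. prod_list (map w us))
      = (\<Sum>k\<le>n. \<Sum>us\<in>(\<lambda>(t, ts). t # ts) ` ({t. tree_size t = k} \<times> forests l (n - k)).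
          prod_list (map w us))"
    unfolding forests_Suc
    by (rule sum.UNION_disjoint) (auto simp: finite_tree_size_eq finite_forests)
  also have "\<dots> = (\<Sum>k\<le>n. \<Sum>(t, ts)\<in>{t. tree_size t = k} \<times> forests l (n - k).
      w t * prod_list (map w ts))"
    by (intro sum.cong refl, subst sum.reindex) (auto simp: inj_on_def intro!: sum.cong)
  also have "\<dots> = (\<Sum>k\<le>n. (\<Sum>t | tree_size t = k. w t) *
      (\<Sum>ts\<in>forests l (n - k). prod_list (map w ts)))"
    by (simp add: sum_product sum.cartesian_product)
  finally show ?case
    by (simp add: Suc.IH fps_mult_nth atMost_atLeast0)
qed

text \<open>Trees are sorted by root degree \<open>l\<close>: the root contributes
  \<open>a l * b s\<close>, and the forest of its subtrees a coefficient of an \<open>l\<close>-th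
  power. Summing over \<open>l\<close> is composition with \<open>Abs_fps a\<close>.\<close>

lemma sum_tree_weight:
  fixes a b :: "nat \<Rightarrow> 'a::comm_ring_1"
  shows "(\<Sum>t\<in>plane_trees s. tree_weight a b t) = b s *
    fps_nth (Abs_fps a oo fps_X * Abs_fps (\<lambda>n. \<Sum>t\<in>plane_trees n. tree_weight a b t)) s"
proof -
  define F where "F = Abs_fps (\<lambda>m. \<Sum>t | tree_size t = m. tree_weight a b t)"
  \<comment> \<open>No tree has size 0, and size exceeds the number of non-root vertices by one;
    hence the factor \<open>fps_X\<close>.\<close>
  have "vertices t \<noteq> {}" for t
    using tree_size_pos[of t] by auto
  then have F: "F = fps_X * Abs_fps (\<lambda>n. \<Sum>t\<in>plane_trees n. tree_weight a b t)"
    by (intro fps_ext) (simp add: F_def plane_trees_eq finite_vertices)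
  \<comment> \<open>Each child accounts for at least one vertex, so the root degree is at most
    \<open>s\<close>, which is also the range of the sum in \<open>fps_compose_nth\<close>.\<close>
  have "plane_trees s = (\<Union>l\<le>s. Node ` forests l s)"
  proof (rule set_eqI)
    fix t
    obtain ts where "t = Node ts" by (cases t)
    then show "t \<in> plane_trees s \<longleftrightarrow> t \<in> (\<Union>l\<le>s. Node ` forests l s)"
      using forests_empty[of s "length ts"]
      by (auto simp: plane_trees_eq tree_size_Node forests_def image_iff not_le[symmetric])
  qed
  then have "(\<Sum>t\<in>plane_trees s. tree_weight a b t)
      = (\<Sum>l\<le>s. \<Sum>t\<in>Node ` forests l s. tree_weight a b t)"
    by (simp only:, intro sum.UNION_disjoint) (auto simp: finite_forests, auto simp: forests_def)
  also have "\<dots> = (\<Sum>l\<le>s. \<Sum>ts\<in>forests l s. b s * (a l * prod_list (map (tree_weight a b) ts)))"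
    by (intro sum.cong refl, subst sum.reindex)
       (auto simp: inj_on_def tree_weight_Node forests_def mult_ac intro!: sum.cong)
  also have "\<dots> = b s * fps_nth (Abs_fps a oo F) s"
    by (simp add: sum_distrib_left[symmetric] sum_forests F_def fps_compose_nth atMost_atLeast0)
  finally show ?thesis by (simp add: F)
qed

subsection \<open>The generating function of the out-degree weights\<close>

text \<open>The only pole in this range is 0. The range reaches below 0 to admit the arguments
  \<open>- (1 / 2)\<close> and \<open>p - 1 / 2\<close>.\<close>

lemma Gamma_nonzero_gt_minus_one: "Gamma x \<noteq> 0" if "x > - 1" "x \<noteq> 0" for x :: real
  using that by (auto simp: Gamma_eq_zero_iff elim!: nonpos_Ints_cases)

lemma coeff_a_0: "coeff_a 0 = - (1 / 2)"
proof -
  have "Gamma (- (1 / 2) + 1 :: real) = - (1 / 2) * Gamma (- (1 / 2))"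
    using Gamma_nonzero_gt_minus_one[of "- (1 / 2)"]
    by (intro Gamma_plus1) (simp add: Gamma_eq_zero_iff)
  then have "Gamma (- (1 / 2) :: real) = - 2 * sqrt pi"
    by (simp add: Gamma_one_half_real)
  then show ?thesis by (simp add: coeff_a_def)
qed

lemma coeff_a_Suc: "coeff_a (Suc l) = 4 * (real l - 1 / 2) / (real l + 1) * coeff_a l"
proof -
  have "real l \<noteq> 1 / 2"
  proof
    assume "real l = 1 / 2"
    then have "real (2 * l) = real 1" by simp
    then have "2 * l = 1" by (simp only: of_nat_eq_iff)
    then show False by presburger
  qed
  then have "Gamma (real l - 1 / 2) \<noteq> 0"
    by (intro Gamma_nonzero_gt_minus_one) auto
  then have 1: "Gamma (real l + 1 / 2) = (real l - 1 / 2) * Gamma (real l - 1 / 2)"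
    using Gamma_plus1[of "real l - 1 / 2"] by (simp add: Gamma_eq_zero_iff add.commute)
  have "Gamma (real l + 1) \<noteq> 0"
    by (intro Gamma_nonzero_gt_minus_one) auto
  then have 2: "Gamma (real l + 2) = (real l + 1) * Gamma (real l + 1)"
    using Gamma_plus1[of "real l + 1"] by (simp add: Gamma_eq_zero_iff add.assoc)
  have 3: "4 powi (int (Suc l) - 1) = 4 * (4 :: real) powi (int l - 1)"
    by (simp add: power_int_diff)
  have 4: "Gamma (real (Suc l) - 1 / 2) = Gamma (real l + 1 / 2)"
    "Gamma (real (Suc l) + 1) = Gamma (real l + 2)"
    by (simp_all add: algebra_simps)
  show ?thesis
    by (simp only: coeff_a_def 1 2 3 4) (simp add: algebra_simps)
qed

lemma coeff_a_eq_gbinomial: "coeff_a l = - (1 / 2) * (- 4) ^ l * ((1 / 2) gchoose l)"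
proof (induction l)
  case 0
  show ?case by (simp add: coeff_a_0)
next
  case (Suc l)
  have "((1 / 2) gchoose Suc l) = (1 / 2 - real l) / (real l + 1) * ((1 / 2 :: real) gchoose l)"
    using gbinomial_mult_1[of "1 / 2 :: real" l] by (simp add: field_simps)
  then show ?case
    by (simp only: coeff_a_Suc Suc.IH power_Suc) (simp add: field_simps)
qed

text \<open>The series is -1/2 times the binomial series of exponent 1/2 at -4x; exponents add under
  multiplication, so the square is (1 - 4x)/4.\<close>

lemma coeff_a_fps_square: "Abs_fps coeff_a ^ 2 = fps_const (1 / 4) - fps_X"
proof -
  let ?L = "fps_const (- 4 :: real) * fps_X"
  have "Abs_fps coeff_a = fps_const (- (1 / 2)) * (fps_binomial (1 / 2) oo ?L)"
    by (intro fps_ext) (simp add: coeff_a_eq_gbinomial fps_compose_linear)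
  then have "Abs_fps coeff_a ^ 2 = fps_const (- (1 / 2)) * fps_const (- (1 / 2)) *
      ((fps_binomial (1 / 2) oo ?L) * (fps_binomial (1 / 2) oo ?L))"
    by (simp only: power2_eq_square mult_ac)
  also have "(fps_binomial (1 / 2) oo ?L) * (fps_binomial (1 / 2) oo ?L)
      = (fps_binomial (1 / 2) * fps_binomial (1 / 2)) oo ?L"
    by (rule fps_compose_mult_distrib[symmetric]) simp
  also have "(fps_binomial (1 / 2) * fps_binomial (1 / 2) :: real fps) = 1 + fps_X"
    by (simp add: fps_binomial_add_mult[symmetric] fps_binomial_1)
  also have "(1 + fps_X) oo ?L = 1 + ?L"
    by (simp add: fps_compose_add_distrib)
  also have "fps_const (- (1 / 2)) * fps_const (- (1 / 2)) * (1 + ?L) = fps_const (1 / 4) - fps_X"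
    by (intro fps_ext) (auto simp: mult.assoc fps_nth_fps_const)
  finally show ?thesis .
qed

subsection \<open>Solving the recursion\<close>

text \<open>Permits the final division by \<open>coeff_b p s\<close>. The denominator needs checking
  too, since division by zero yields zero.\<close>

lemma coeff_b_nonzero:
  assumes "p > 0" and "p \<noteq> 1 / 2"
  shows "coeff_b p k \<noteq> 0"
proof (cases k)
  case 0
  then show ?thesis
    using assms Gamma_nonzero_gt_minus_one[of "p - 1 / 2"]
      Gamma_nonzero_gt_minus_one[of "- (1 / 2)"]
    by (simp add: coeff_b_def)
next
  case (Suc n)
  \<comment> \<open>Rewriting with \<open>k = Suc n\<close> makes it visible that both Gamma
    arguments are positive.\<close>
  have "(real k + 1) * (p - 1 / 2) + real k = (real k + 1) * p + real n / 2"
    "real k * (p - 1 / 2) + real k - 1 / 2 = real k * p + real n / 2"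
    by (simp_all add: Suc field_simps)
  moreover have "(real k + 1) * p + real n / 2 > 0" "real k * p + real n / 2 > 0"
    using assms(1) Suc by (simp_all add: add_pos_nonneg)
  ultimately have "Gamma ((real k + 1) * (p - 1 / 2) + real k) \<noteq> 0"
    "Gamma (real k * (p - 1 / 2) + real k - 1 / 2) \<noteq> 0"
    by (metis Gamma_nonzero_gt_minus_one less_numeral_extra(3) minus_less_iff neg_0_less_iff_less
        order_less_trans zero_less_one neg_less_0_iff_less)+
  then show ?thesis by (simp only: coeff_b_def) (metis divide_eq_0_iff mult_eq_0_iff zero_neq_numeral)
qed

text \<open>The initial value at \<open>s = 1\<close> fits the general recursion with an empty sum,
  because \<open>coeff_b p 0 * muE p 0\<close> contains
  \<open>Gamma (- (1 / 2)) = - 2 * sqrt pi\<close>.\<close>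

lemma muE_rec:
  assumes "s > 0"
  shows "muE p s = coeff_b p (s - 1) * muE p (s - 1) + (\<Sum>k = 1..s - 1. muE p k * muE p (s - k))"
proof (cases "s = 1")
  case True
  have "Gamma (- (1 / 2)) = - 2 * sqrt pi"
    using coeff_a_0 by (simp add: coeff_a_def field_simps)
  then show ?thesis
    using True by (simp add: muE.simps[of p "Suc 0"] muE.simps[of p 0] coeff_b_def)
next
  case False
  have "(real (s - 1) + 1) * (p - 1 / 2) + real (s - 1) = real s * (p + 1 / 2) - 1"
    "real (s - 1) * (p - 1 / 2) + real (s - 1) - 1 / 2 = real s * (p + 1 / 2) - p - 1"
    using assms by (simp_all add: of_nat_diff field_simps)
  then have "coeff_b p (s - 1) = Gamma (real s * (p + 1 / 2) - 1)
      / (2 * Gamma (real s * (p + 1 / 2) - p - 1))"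
    by (simp only: coeff_b_def)
  then show ?thesis
    using assms False by (subst muE.simps) simp
qed

theorem proposition6:
  fixes p :: real and s :: nat
  assumes "p > 0" and "p \<noteq> 1 / 2"
  shows "muE p s = 1 / coeff_b p s *
    (\<Sum>T\<in>plane_trees s. \<Prod>v\<in>vertices T.
        coeff_a (out_degree T v) * coeff_b p (num_descendants T v))"
proof -
  define W where
    "W = Abs_fps (\<lambda>n. \<Sum>T\<in>plane_trees n. tree_weight coeff_a (coeff_b p) T)"
  define M where "M = Abs_fps coeff_a oo fps_X * W"
  have W: "fps_nth W n = coeff_b p n * fps_nth M n" for n
    unfolding M_def W_def by (subst sum_tree_weight[symmetric]) simp
  have M0: "fps_nth M 0 = - (1 / 2)"
    by (simp add: M_def coeff_a_0)
  have "M ^ 2 = (Abs_fps coeff_a ^ 2) oo fps_X * W"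
    unfolding M_def by (rule fps_compose_power) simp
  also have "\<dots> = fps_const (1 / 4) - fps_X * W"
    by (simp add: coeff_a_fps_square fps_compose_sub_distrib)
  finally have M2: "M * M = fps_const (1 / 4) - fps_X * W"
    by (simp add: power2_eq_square)
  have M_rec: "fps_nth M n = coeff_b p (n - 1) * fps_nth M (n - 1)
      + (\<Sum>k = 1..n - 1. fps_nth M k * fps_nth M (n - k))" if pos: "n > 0" for n
  proof -
    obtain m where n: "n = Suc m" using pos gr0_implies_Suc by blast
    have "fps_nth (M * M) n = - (coeff_b p m * fps_nth M m)"
      by (simp add: M2 W n)
    \<comment> \<open>The two end terms of the convolution each equal \<open>fps_nth M n\<close>
      times the constant term -1/2, and together give \<open>- fps_nth M n\<close>.\<close>
    moreover have "fps_nth (M * M) n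
        = (\<Sum>k = 1..m. fps_nth M k * fps_nth M (n - k)) - fps_nth M n"
      by (simp add: fps_mult_nth n sum.atLeast_Suc_atMost M0 field_simps)
    ultimately show ?thesis by (simp add: n)
  qed
  have "muE p n = fps_nth M n" for n
  proof (induction n rule: less_induct)
    case (less n)
    show ?case
    proof (cases "n = 0")
      case True
      then show ?thesis by (simp add: M0 muE.simps[of p 0])
    next
      case False
      \<comment> \<open>Both recursions have the same form and involve only the indices
        \<open>n - 1\<close>, \<open>k\<close> and \<open>n - k\<close>, all below
        \<open>n\<close>.\<close>
      then show ?thesis
        by (subst muE_rec, simp, subst M_rec, simp)
           (intro arg_cong2[where f = "(+)"] arg_cong2[where f = "(*)"] sum.cong less.IH; force)
    qed
  qed
  then have "muE p s = 1 / coeff_b p s * fps_nth W s"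
    using coeff_b_nonzero[OF assms] by (simp add: W)
  then show ?thesis by (simp add: W_def tree_weight_def)
qed

end
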